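(* Let $\varphi:[0,\infty]\to[0,\infty]$ be an upper-semicontinuous function such that $\varphi(t)<t$ for any $t\notin\{0,\infty\}$ and $\varphi(0)=0$. Let $f:X\to X$ be a map on a Cauchy-complete generalized metric space $(X,d)$ such that $d(fx,fy)\le\varphi(d(x,y))$ for all $x,y\in X$. If there is an $x\in X$ such that $d(x,fx)\neq\infty\neq d(fx,x)$, then the sequence $(f^nx)_{n\in\mathbb{N}}$ converges to a fixpoint of $f$.
   Context: Here $\le$ and $<$ denote the usual order on $[0,\infty]$. A generalized metric space $(X,d)$ is a set $X$ with a map $d:X\times X\to[0,\infty]$ such that $d(x,y)+d(y,z)\ge d(x,z)$ and $d(x,x)=0$; $d$ may take the value $\infty$, need not be symmetric, and $d(x,y)=0=d(y,x)$ is allowed for $x\ne y$. (This is a category enriched in the quantale $([0,\infty],\bigwedge,+,0)$, which carries the reverse of the usual order.) A sequence $(x_n)$ in $X$ is Cauchy if $\inf_{N}\sup_{n,m\ge N}d(x_n,x_m)=0$; it converges to $u\in X$ if for all $y\in X$, $d(y,u)=\inf_N\sup_{n\ge N}d(y,x_n)$ and $d(u,y)=\inf_N\sup_{n\ge N}d(x_n,y)$ (for a Cauchy sequence this amounts to $d(x_n,u)\to0$ and $d(u,x_n)\to 0$). $(X,d)$ is Cauchy-complete if every Cauchy sequence converges; equivalently, in enriched terms, whenever $\phi,\psi:X\to[0,\infty]$ satisfy $d(y',y)+\phi(y)\ge\phi(y')$, $\psi(y)+d(y,y')\ge\psi(y')$, $\inf_y(\psi(y)+\phi(y))=0$ and $\phi(y)+\psi(y')\ge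 d(y,y')$ for all $y,y'$, there is $u\in X$ with $\phi=d(-,u)$. A fixpoint of $f$ is a $u\in X$ with $d(fu,u)=0=d(u,fu)$. Upper-semicontinuity of $\varphi$ is lower-semicontinuity with respect to the reversed order: for every net $(t_i)_{i\in I}$ in $[0,\infty]$ indexed by a directed poset $I$, $\inf_{i}\sup_{j\ge i}\varphi(t_j)\le\varphi(\inf_i\sup_{j\ge i}t_j)$. *)

theory Defs
  imports "HOL-Analysis.Analysis"
begin

text \<open>
  As in \<^locale>\<open>Metric_space\<close>, the underlying set is an explicit carrier.
  Distances are in \<^typ>\<open>ennreal\<close>, with its usual order.
\<close>

locale generalized_metric_space =
  fixes X :: "'a set" and d :: "'a \<Rightarrow> 'a \<Rightarrow> ennreal"
  assumes triangle: "\<lbrakk>x \<in> X; y \<in> X; z \<in> X\<rbrakk> \<Longrightarrow> d x z \<le> d x y + d y z"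
    and dist_self: "x \<in> X \<Longrightarrow> d x x = 0"

definition gm_Cauchy :: "'a set \<Rightarrow> ('a \<Rightarrow> 'a \<Rightarrow> ennreal) \<Rightarrow> (nat \<Rightarrow> 'a) \<Rightarrow> bool" where
  "gm_Cauchy X d s \<longleftrightarrow>
     range s \<subseteq> X \<and> (INF N. SUP (n, m)\<in>{N..} \<times> {N..}. d (s n) (s m)) = 0"

definition gm_converges :: "'a set \<Rightarrow> ('a \<Rightarrow> 'a \<Rightarrow> ennreal) \<Rightarrow> (nat \<Rightarrow> 'a) \<Rightarrow> 'a \<Rightarrow> bool" where
  "gm_converges X d s u \<longleftrightarrow>
     range s \<subseteq> X \<and> u \<in> X \<and>
     (\<forall>y\<in>X. d y u = (INF N. SUP n\<in>{N..}. d y (s n)) \<and>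
            d u y = (INF N. SUP n\<in>{N..}. d (s n) y))"

definition Cauchy_complete :: "'a set \<Rightarrow> ('a \<Rightarrow> 'a \<Rightarrow> ennreal) \<Rightarrow> bool" where
  "Cauchy_complete X d \<longleftrightarrow> (\<forall>s. gm_Cauchy X d s \<longrightarrow> (\<exists>u. gm_converges X d s u))"

text \<open>Fixpoints are taken up to the equivalence identifying points at distance 0 both ways.\<close>

definition gm_fixpoint :: "'a set \<Rightarrow> ('a \<Rightarrow> 'a \<Rightarrow> ennreal) \<Rightarrow> ('a \<Rightarrow> 'a) \<Rightarrow> 'a \<Rightarrow> bool" where
  "gm_fixpoint X d f u \<longleftrightarrow> u \<in> X \<and> d (f u) u = 0 \<and> d u (f u) = 0"

definition directed_poset :: "'i set \<Rightarrow> 'i rel \<Rightarrow> bool" where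
  "directed_poset I r \<longleftrightarrow>
     I \<noteq> {} \<and> partial_order_on I r \<and> (\<forall>i\<in>I. \<forall>j\<in>I. \<exists>k\<in>I. (i, k) \<in> r \<and> (j, k) \<in> r)"

definition net_limsup :: "'i set \<Rightarrow> 'i rel \<Rightarrow> ('i \<Rightarrow> ennreal) \<Rightarrow> ennreal" where
  "net_limsup I r t = (INF i\<in>I. SUP j\<in>{j\<in>I. (i, j) \<in> r}. t j)"

text \<open>
  The definition should range over nets indexed by arbitrary directed posets, which cannot be
  quantified over all index types inside a formula. The index type is therefore fixed to
  \<^typ>\<open>ennreal set\<close>; the lemma \<open>upper_semicontinuous_net\<close> below shows that the
  inequality then holds for nets over every index type, so nothing is lost.

  This is upper semicontinuity for the reversed quantale order, not for the usual topology:
  applied to alternating sequences it also forces monotonicity.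
\<close>

definition upper_semicontinuous :: "(ennreal \<Rightarrow> ennreal) \<Rightarrow> bool" where
  "upper_semicontinuous \<phi> \<longleftrightarrow>
     (\<forall>(I :: ennreal set set) r t. directed_poset I r \<longrightarrow>
        net_limsup I r (\<lambda>i. \<phi> (t i)) \<le> \<phi> (net_limsup I r t))"

lemma upper_semicontinuous_sequence:
  fixes s :: "nat \<Rightarrow> ennreal"
  assumes "upper_semicontinuous \<phi>"
  shows "(INF N. SUP n\<in>{N..}. \<phi> (s n)) \<le> \<phi> (INF N. SUP n\<in>{N..}. s n)"
proof -
  define g :: "nat \<Rightarrow> ennreal set" where "g n = {of_nat n}" for n
  define r where "r = {(g m, g n) | m n. m \<le> n}"
  have inj: "inj g"
    by (auto simp: inj_def g_def)
  have dir: "directed_poset (range g) r"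
    unfolding directed_poset_def
  proof (intro conjI)
    show "partial_order_on (range g) r"
      unfolding partial_order_on_def preorder_on_def
      by (auto simp: r_def refl_on_def trans_def antisym_def inj_eq[OF inj])
    show "\<forall>i\<in>range g. \<forall>j\<in>range g. \<exists>k\<in>range g. (i, k) \<in> r \<and> (j, k) \<in> r"
      unfolding r_def by simp (metis max.cobounded1 max.cobounded2)
  qed simp
  have up: "{j \<in> range g. (g N, j) \<in> r} = g ` {N..}" for N
    by (auto simp: r_def dest: injD[OF inj])
  have lim: "net_limsup (range g) r (\<lambda>i. h (inv g i)) = (INF N. SUP n\<in>{N..}. h n)"
    for h :: "nat \<Rightarrow> ennreal"
    unfolding net_limsup_def by (simp add: image_image up inv_f_f[OF inj])
  show ?thesis
    using assms[unfolded upper_semicontinuous_def, rule_format, OF dir, of "\<lambda>i. s (inv g i)"]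
    by (simp add: lim lim[of "\<lambda>n. \<phi> (s n)"])
qed

lemma upper_semicontinuous_mono:
  assumes "upper_semicontinuous \<phi>" and "a \<le> b"
  shows "\<phi> a \<le> \<phi> b"
proof -
  define s where "s n = (if even n then a else b)" for n :: nat
  have "\<phi> a \<le> (INF N. SUP n\<in>{N..}. \<phi> (s n))"
  proof (rule INF_greatest)
    fix N :: nat
    show "\<phi> a \<le> (SUP n\<in>{N..}. \<phi> (s n))"
      by (rule SUP_upper2[of "2 * N"]) (auto simp: s_def)
  qed
  also have "\<dots> \<le> \<phi> (INF N. SUP n\<in>{N..}. s n)"
    by (rule upper_semicontinuous_sequence[OF assms(1)])
  also have "(INF N. SUP n\<in>{N..}. s n) = b"
  proof -
    have "(SUP n\<in>{N..}. s n) = b" for N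
    proof (rule antisym)
      show "(SUP n\<in>{N..}. s n) \<le> b"
        by (rule SUP_least) (use assms(2) in \<open>simp add: s_def\<close>)
      show "b \<le> (SUP n\<in>{N..}. s n)"
        by (rule SUP_upper2[of "Suc (2 * N)"]) (auto simp: s_def)
    qed
    then show ?thesis by simp
  qed
  finally show ?thesis .
qed

lemma upper_semicontinuous_net:
  fixes I :: "'i set" and t :: "'i \<Rightarrow> ennreal"
  assumes usc: "upper_semicontinuous \<phi>" and dir: "directed_poset I r"
  shows "net_limsup I r (\<lambda>i. \<phi> (t i)) \<le> \<phi> (net_limsup I r t)"
proof -
  define L where "L = net_limsup I r t"
  have below: "net_limsup I r (\<lambda>i. \<phi> (t i)) \<le> \<phi> c"
    if "i \<in> I" and "\<And>j. j \<in> I \<Longrightarrow> (i, j) \<in> r \<Longrightarrow> t j \<le> c" for c i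
    unfolding net_limsup_def using that
    by (intro INF_lower2[of i] SUP_least upper_semicontinuous_mono[OF usc]) auto
  show ?thesis
  proof (cases "L = \<infinity>")
    case True
    obtain i where "i \<in> I" using dir by (auto simp: directed_poset_def)
    then show ?thesis using below[of i \<infinity>] True by (simp add: L_def)
  next
    case False
    define s where "s n = L + ennreal (1 / real (Suc n))" for n
    have "s \<longlonglongrightarrow> L + ennreal 0"
      unfolding s_def
      by (intro tendsto_add tendsto_const tendsto_ennrealI LIMSEQ_Suc[OF lim_1_over_n])
    then have lim: "(INF N. SUP n\<in>{N..}. s n) = L"
      using lim_imp_Limsup[of sequentially s L] by (simp add: limsup_INF_SUP)
    have le: "net_limsup I r (\<lambda>i. \<phi> (t i)) \<le> \<phi> (s n)" for n
    proof -
      have "L < s n"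
        using False by (auto simp: s_def ennreal_add_left_cancel_less[of L 0, simplified] less_top[symmetric])
      then obtain i where "i \<in> I" "(SUP j\<in>{j\<in>I. (i, j) \<in> r}. t j) < s n"
        by (auto simp: L_def net_limsup_def INF_less_iff)
      then show ?thesis
        by (intro below[of i]) (auto intro: SUP_upper2 less_imp_le dest: SUP_lessD)
    qed
    have "net_limsup I r (\<lambda>i. \<phi> (t i)) \<le> (INF N. SUP n\<in>{N..}. \<phi> (s n))"
      by (auto intro!: INF_greatest intro: SUP_upper2 le)
    also have "\<dots> \<le> \<phi> L"
      using upper_semicontinuous_sequence[OF usc, of s] by (simp add: lim)
    finally show ?thesis by (simp add: L_def)
  qed
qed

end

theory Submission
  imports Defs
begin

text \<open>
  The inequality defining upper semicontinuity of \<open>\<phi>\<close> for the reversed order also makes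
  \<open>\<phi>\<close> monotone, by \<open>upper_semicontinuous_mono\<close>, and monotonicity is what makes a direct argument
  possible.

  Let \<open>s n\<close> be the orbit of \<open>x\<close>. Its consecutive distances \<open>a n = d (s n) (s (Suc n))\<close> satisfy
  \<open>a (Suc n) \<le> \<phi> (a n) \<le> a n\<close>, so they decrease to some \<open>L\<close>, which is finite because \<open>a 0\<close> is.
  Semicontinuity gives \<open>L \<le> \<phi> L\<close>, and this excludes every finite \<open>L\<close> except \<open>0\<close>
  (\<open>contracting_sequence_tends_to_0\<close>).

  For the Cauchy property fix a finite \<open>e > 0\<close>. The gap \<open>e - \<phi> e\<close> is positive, so from some index
  on a single step is shorter than it. The set of points within \<open>e\<close> of such an \<open>s n\<close> then
  traps the orbit: if \<open>d (s n) y \<le> e\<close>, then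
  \<open>d (s n) (f y) \<le> d (s n) (s (Suc n)) + \<phi> (d (s n) y) \<le> (e - \<phi> e) + \<phi> e = e\<close>
  (\<open>orbit_forward_small\<close>). As the distance is not symmetric, this controls only
  \<open>d (s n) (s m)\<close> with \<open>n \<le> m\<close>; the other half is the same statement for the opposite space, and
  this is where finiteness of \<open>d (f x) x\<close> enters.

  Finally, \<open>f\<close> is nonexpansive because \<open>\<phi> t \<le> t\<close>, so it preserves convergence to the limit \<open>u\<close>
  of the orbit; the shifted orbit then tends both to \<open>u\<close> and to \<open>f u\<close>, which are therefore at
  distance \<open>0\<close> in both directions.
\<close>

text \<open>
  The values decrease, so their limsup is their infimum \<open>L\<close>. Passing to the limit in
  \<open>a (Suc n) \<le> \<phi> (a n)\<close> yields \<open>L \<le> \<phi> L\<close>.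
\<close>

lemma contracting_sequence_tends_to_0:
  fixes a :: "nat \<Rightarrow> ennreal"
  assumes usc: "upper_semicontinuous \<phi>"
    and below: "\<And>t. t \<notin> {0, \<infinity>} \<Longrightarrow> \<phi> t < t" and zero: "\<phi> 0 = 0"
    and step: "\<And>n. a (Suc n) \<le> \<phi> (a n)" and fin: "a 0 \<noteq> \<infinity>" and "0 < e"
  shows "\<exists>N. \<forall>n\<ge>N. a n < e"
proof -
  have le: "\<phi> t \<le> t" for t
    using below[of t] zero by (cases "t \<in> {0, \<infinity>}") (auto intro: less_imp_le)
  have dec: "decseq a"
    by (rule decseq_SucI) (rule order_trans[OF step le])
  define L where "L = (INF N. a N)"
  have sup: "(SUP n\<in>{N..}. a n) = a N" for N
    by (rule antisym) (auto intro!: SUP_least SUP_upper2[of N] decseqD[OF dec])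
  have "L \<le> (INF N. SUP n\<in>{N..}. \<phi> (a n))"
  proof (rule INF_greatest)
    fix N
    have "L \<le> a (Suc N)"
      unfolding L_def by (rule INF_lower) simp
    also have "\<dots> \<le> \<phi> (a N)"
      by (rule step)
    also have "\<dots> \<le> (SUP n\<in>{N..}. \<phi> (a n))"
      by (rule SUP_upper) simp
    finally show "L \<le> (SUP n\<in>{N..}. \<phi> (a n))" .
  qed
  also have "\<dots> \<le> \<phi> L"
    using upper_semicontinuous_sequence[OF usc, of a] by (simp add: sup L_def)
  finally have "L \<le> \<phi> L" .
  moreover have "L \<noteq> \<infinity>"
    using fin INF_lower[of 0 UNIV a] by (auto simp: L_def top_unique)
  ultimately have "L = 0"
    using below[of L] by force
  then obtain N where "a N < e"
    using \<open>0 < e\<close> unfolding L_def using INF_less_iff[of a UNIV e] by auto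
  then show ?thesis
    using decseqD[OF dec] by (blast intro: le_less_trans)
qed

text \<open>
  The hypotheses on the contraction are gathered here because they are invariant under reversing
  the distance, which exchanges the two halves of every estimate below.
\<close>

locale nonlinear_contraction = generalized_metric_space X d
  for X :: "'a set" and d :: "'a \<Rightarrow> 'a \<Rightarrow> ennreal" +
  fixes \<phi> :: "ennreal \<Rightarrow> ennreal" and f :: "'a \<Rightarrow> 'a"
  assumes usc: "upper_semicontinuous \<phi>"
    and phi_less: "\<And>t. t \<notin> {0, \<infinity>} \<Longrightarrow> \<phi> t < t"
    and phi_0: "\<phi> 0 = 0"
    and f_in: "f \<in> X \<rightarrow> X"
    and contraction: "\<And>x y. \<lbrakk>x \<in> X; y \<in> X\<rbrakk> \<Longrightarrow> d (f x) (f y) \<le> \<phi> (d x y)"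
begin

lemma opposite: "nonlinear_contraction X (\<lambda>x y. d y x) \<phi> f"
proof
  show "d z x \<le> d y x + d z y" if "x \<in> X" "y \<in> X" "z \<in> X" for x y z
    using triangle[of z y x] that by (simp add: add.commute)
qed (use usc phi_less phi_0 f_in contraction dist_self in auto)

lemma nonexpansive:
  assumes "x \<in> X" "y \<in> X"
  shows "d (f x) (f y) \<le> d x y"
proof -
  have "\<phi> t \<le> t" for t
    using phi_less[of t] phi_0 by (cases "t \<in> {0, \<infinity>}") (auto intro: less_imp_le)
  then show ?thesis
    using contraction[OF assms] order_trans by blast
qed

lemma orbit_in:
  assumes "x \<in> X"
  shows "(f ^^ n) x \<in> X"
  by (induction n) (use assms f_in in auto)

text \<open>
  Once single steps are shorter than the gap \<open>e - \<phi> e\<close>, the contraction of distances up to \<open>e\<close>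
  compensates for the step, so no distance from \<open>(f ^^ n) x\<close> to a later point ever exceeds \<open>e\<close>.
\<close>

lemma orbit_forward_small:
  assumes x: "x \<in> X" and fin: "d x (f x) \<noteq> \<infinity>" and "0 < e"
  shows "\<exists>N. \<forall>n\<ge>N. \<forall>m\<ge>n. d ((f ^^ n) x) ((f ^^ m) x) \<le> e"
proof (cases "e = \<infinity>")
  case True
  then show ?thesis by simp
next
  case False
  define s where "s n = (f ^^ n) x" for n
  have s_in: "s n \<in> X" for n
    unfolding s_def by (rule orbit_in[OF x])
  have s_Suc: "s (Suc n) = f (s n)" for n
    by (simp add: s_def)
  have gap: "\<phi> e < e"
    using phi_less[of e] False \<open>0 < e\<close> by simp
  have "\<exists>N. \<forall>n\<ge>N. d (s n) (s (Suc n)) < e - \<phi> e"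
  proof (rule contracting_sequence_tends_to_0[OF usc phi_less phi_0])
    show "d (s (Suc n)) (s (Suc (Suc n))) \<le> \<phi> (d (s n) (s (Suc n)))" for n
      using contraction[OF s_in s_in, of n "Suc n"] by (simp add: s_Suc)
    show "d (s 0) (s (Suc 0)) \<noteq> \<infinity>"
      using fin by (simp add: s_def)
    show "0 < e - \<phi> e"
      using gap by (simp add: diff_gr0_ennreal)
  qed
  then obtain N where N: "d (s n) (s (Suc n)) \<le> e - \<phi> e" if "N \<le> n" for n
    by (blast intro: less_imp_le)
  have "d (s n) (s m) \<le> e" if "N \<le> n" "n \<le> m" for n m
    using \<open>n \<le> m\<close>
  proof (induction m rule: dec_induct)
    case base
    then show ?case by (simp add: dist_self s_in)
  next
    case (step m)
    have "d (s n) (s (Suc m)) \<le> d (s n) (s (Suc n)) + d (s (Suc n)) (s (Suc m))"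
      by (intro triangle s_in)
    also have "\<dots> \<le> (e - \<phi> e) + \<phi> (d (s n) (s m))"
      using N[OF \<open>N \<le> n\<close>] contraction[OF s_in s_in, of n m] by (auto simp: s_Suc intro: add_mono)
    also have "\<dots> \<le> (e - \<phi> e) + \<phi> e"
      by (intro add_left_mono upper_semicontinuous_mono[OF usc] step.IH)
    also have "\<dots> = e"
      using gap by (simp add: diff_add_cancel_ennreal less_imp_le)
    finally show ?case .
  qed
  then show ?thesis
    unfolding s_def by blast
qed

lemma orbit_Cauchy:
  assumes x: "x \<in> X" and "d x (f x) \<noteq> \<infinity>" "d (f x) x \<noteq> \<infinity>"
  shows "gm_Cauchy X d (\<lambda>n. (f ^^ n) x)"
proof -
  let ?s = "\<lambda>n. (f ^^ n) x"
  interpret op: nonlinear_contraction X "\<lambda>x y. d y x" \<phi> f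
    by (rule opposite)
  have "(INF N. SUP (n, m)\<in>{N..} \<times> {N..}. d (?s n) (?s m)) \<le> e" if "0 < e" for e
  proof -
    obtain N where N: "\<forall>n\<ge>N. \<forall>m\<ge>n. d (?s n) (?s m) \<le> e"
      using orbit_forward_small[OF x assms(2) \<open>0 < e\<close>] ..
    obtain M where M: "\<forall>n\<ge>M. \<forall>m\<ge>n. d (?s m) (?s n) \<le> e"
      using op.orbit_forward_small[OF x assms(3) \<open>0 < e\<close>] ..
    have "d (?s n) (?s m) \<le> e" if "max N M \<le> n" "max N M \<le> m" for n m
      using N M that by (cases n m rule: le_cases) auto
    then show ?thesis
      by (intro INF_lower2[of "max N M"] SUP_least) auto
  qed
  then have "(INF N. SUP (n, m)\<in>{N..} \<times> {N..}. d (?s n) (?s m)) \<le> 0"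
    by (rule dense_ge)
  then show ?thesis
    using orbit_in[OF x] by (auto simp: gm_Cauchy_def)
qed

text \<open>
  The sequence \<open>(f ^^ Suc n) x\<close> links \<open>f u\<close> and \<open>u\<close>: it is close to \<open>u\<close> as part of the orbit, and
  close to \<open>f u\<close> because \<open>f\<close> is nonexpansive.
\<close>

lemma orbit_limit_fixpoint:
  assumes x: "x \<in> X" and conv: "gm_converges X d (\<lambda>n. (f ^^ n) x) u"
  shows "gm_fixpoint X d f u"
proof -
  let ?s = "\<lambda>n. (f ^^ n) x"
  have u: "u \<in> X" and fu: "f u \<in> X"
    using conv f_in by (auto simp: gm_converges_def)
  have s_in: "?s n \<in> X" for n
    by (rule orbit_in[OF x])
  \<comment> \<open>Testing convergence at the point \<open>u\<close> itself, where both limsups equal \<open>d u u = 0\<close>.\<close>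
  have to_u: "(INF N. SUP n\<in>{N..}. d u (?s n)) = 0" "(INF N. SUP n\<in>{N..}. d (?s n) u) = 0"
    using conv u dist_self[OF u] by (auto simp: gm_converges_def)
  have "d (f u) u \<le> e \<and> d u (f u) \<le> e" if "0 < e" for e
  proof -
    have half: "0 < e / 2"
      using that by (simp add: ennreal_zero_less_divide)
    obtain N where "(SUP n\<in>{N..}. d u (?s n)) < e / 2"
      using to_u(1) half by (metis (no_types, lifting) INF_less_iff)
    then have N: "d u (?s n) \<le> e / 2" if "N \<le> n" for n
      using that by (meson SUP_lessD atLeast_iff less_imp_le)
    obtain M where "(SUP n\<in>{M..}. d (?s n) u) < e / 2"
      using to_u(2) half by (metis (no_types, lifting) INF_less_iff)
    then have M: "d (?s n) u \<le> e / 2" if "M \<le> n" for n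
      using that by (meson SUP_lessD atLeast_iff less_imp_le)
    define n where "n = max N M"
    have e: "e / 2 + e / 2 = e"
      using mult_divide_eq_ennreal[of 2 e]
      by (simp add: mult_2_right add_divide_distrib_ennreal)
    have "d (f u) u \<le> d (f u) (?s (Suc n)) + d (?s (Suc n)) u"
      by (intro triangle fu u s_in)
    also have "\<dots> \<le> e / 2 + e / 2"
      using nonexpansive[OF u s_in, of n] N[of n] M[of "Suc n"]
      by (intro add_mono) (auto simp: n_def intro: order_trans)
    finally have *: "d (f u) u \<le> e"
      by (simp only: e)
    have "d u (f u) \<le> d u (?s (Suc n)) + d (?s (Suc n)) (f u)"
      by (intro triangle fu u s_in)
    also have "\<dots> \<le> e / 2 + e / 2"
      using nonexpansive[OF s_in u, of n] N[of "Suc n"] M[of n]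
      by (intro add_mono) (auto simp: n_def intro: order_trans)
    finally show ?thesis
      using * by (simp only: e simp_thms)
  qed
  then have "d (f u) u \<le> 0" "d u (f u) \<le> 0"
    by (blast intro: dense_ge)+
  then show ?thesis
    using u by (simp add: gm_fixpoint_def)
qed

end

theorem corollary3p2p1:
  fixes X :: "'a set" and d :: "'a \<Rightarrow> 'a \<Rightarrow> ennreal"
    and \<phi> :: "ennreal \<Rightarrow> ennreal" and f :: "'a \<Rightarrow> 'a" and x :: 'a
  assumes "upper_semicontinuous \<phi>"
    and "\<And>t. t \<notin> {0, \<infinity>} \<Longrightarrow> \<phi> t < t"
    and "\<phi> 0 = 0"
    and "generalized_metric_space X d"
    and "Cauchy_complete X d"
    and "f \<in> X \<rightarrow> X"
    and "\<And>x y. \<lbrakk>x \<in> X; y \<in> X\<rbrakk> \<Longrightarrow> d (f x) (f y) \<le> \<phi> (d x y)"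
    and "x \<in> X" and "d x (f x) \<noteq> \<infinity>" and "d (f x) x \<noteq> \<infinity>"
  shows "\<exists>u. gm_fixpoint X d f u \<and> gm_converges X d (\<lambda>n. (f ^^ n) x) u"
proof -
  interpret nonlinear_contraction X d \<phi> f
    using assms by (simp add: nonlinear_contraction_def nonlinear_contraction_axioms_def)
  obtain u where "gm_converges X d (\<lambda>n. (f ^^ n) x) u"
    using orbit_Cauchy[OF assms(8-10)] \<open>Cauchy_complete X d\<close> by (auto simp: Cauchy_complete_def)
  then show ?thesis
    using orbit_limit_fixpoint[OF \<open>x \<in> X\<close>] by blast
qed

end
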